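(* Any prodiscrete monoid is a (right) powder monoid.
   Context: A prodiscrete monoid is a topological monoid $(M,\tau)$ obtained as a limit $M=\varprojlim_{i\in I}M_i$ of a small diagram of discrete monoids and monoid homomorphisms (not necessarily filtered, nor with surjective maps), with $\tau$ the coarsest topology making each projection $\pi_i:M\to M_i$ continuous. For a monoid $M$, $A\subseteq M$, $p\in M$: $p^*(A)=\{m\mid pm\in A\}$, $\mathcal{I}_A^p=\{m\mid m^*(A)=p^*(A)\}$. The action topology induced by a topology $\tau$ on $M$ has base $\{A\subseteq M\mid\forall p,q\in M,\ \mathcal{I}^p_{q^*(A)}\in\tau\}$; $\tau$ is an action topology if it equals the action topology it induces. A (right) powder monoid is a topological monoid $(M,\tau)$ which is $T_0$ and such that $\tau$ is an action topology. *)

theory Defs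
  imports "HOL-Analysis.Analysis" "HOL-Algebra.Product_Groups"
begin

record ('o, 'f) cat_data =
  Obj :: "'o set"
  Arr :: "'f set"
  Src :: "'f \<Rightarrow> 'o"
  Tgt :: "'f \<Rightarrow> 'o"
  Ident :: "'o \<Rightarrow> 'f"
  Comp :: "'f \<Rightarrow> 'f \<Rightarrow> 'f"

text \<open>\<open>Comp C g f\<close> is the composite \<open>g \<circ> f\<close>; it is only meaningful if \<open>Src C g = Tgt C f\<close>.\<close>

definition small_category :: "('o, 'f) cat_data \<Rightarrow> bool" where
  "small_category C \<longleftrightarrow>
     (\<forall>f\<in>Arr C. Src C f \<in> Obj C \<and> Tgt C f \<in> Obj C) \<and>
     (\<forall>i\<in>Obj C. Ident C i \<in> Arr C \<and> Src C (Ident C i) = i \<and> Tgt C (Ident C i) = i) \<and>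
     (\<forall>f\<in>Arr C. \<forall>g\<in>Arr C. Src C g = Tgt C f \<longrightarrow>
        Comp C g f \<in> Arr C \<and> Src C (Comp C g f) = Src C f \<and> Tgt C (Comp C g f) = Tgt C g) \<and>
     (\<forall>f\<in>Arr C. Comp C f (Ident C (Src C f)) = f \<and> Comp C (Ident C (Tgt C f)) f = f) \<and>
     (\<forall>f\<in>Arr C. \<forall>g\<in>Arr C. \<forall>k\<in>Arr C. Src C g = Tgt C f \<and> Src C k = Tgt C g \<longrightarrow>
        Comp C k (Comp C g f) = Comp C (Comp C k g) f)"

text \<open>The library's \<^const>\<open>hom\<close> does not ask for preservation of the unit.\<close>

definition monoid_hom :: "'a monoid \<Rightarrow> 'b monoid \<Rightarrow> ('a \<Rightarrow> 'b) set" where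
  "monoid_hom M N = {f \<in> hom M N. f \<one>\<^bsub>M\<^esub> = \<one>\<^bsub>N\<^esub>}"

text \<open>A functor from \<open>C\<close> to monoids, with object part \<open>D\<close> and arrow part \<open>h\<close>. That the \<open>D i\<close> share
  one element type is no restriction: a set-indexed family embeds in its disjoint union.\<close>

definition monoid_diagram ::
  "('o, 'f) cat_data \<Rightarrow> ('o \<Rightarrow> 'a monoid) \<Rightarrow> ('f \<Rightarrow> 'a \<Rightarrow> 'a) \<Rightarrow> bool" where
  "monoid_diagram C D h \<longleftrightarrow>
     small_category C \<and>
     (\<forall>i\<in>Obj C. Group.monoid (D i)) \<and>
     (\<forall>f\<in>Arr C. h f \<in> monoid_hom (D (Src C f)) (D (Tgt C f))) \<and>
     (\<forall>i\<in>Obj C. \<forall>x\<in>carrier (D i). h (Ident C i) x = x) \<and>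
     (\<forall>f\<in>Arr C. \<forall>g\<in>Arr C. Src C g = Tgt C f \<longrightarrow>
        (\<forall>x\<in>carrier (D (Src C f)). h (Comp C g f) x = h g (h f x)))"

definition monoid_cone ::
  "('o, 'f) cat_data \<Rightarrow> ('o \<Rightarrow> 'a monoid) \<Rightarrow> ('f \<Rightarrow> 'a \<Rightarrow> 'a) \<Rightarrow>
   'm monoid \<Rightarrow> ('o \<Rightarrow> 'm \<Rightarrow> 'a) \<Rightarrow> bool" where
  "monoid_cone C D h M \<pi> \<longleftrightarrow>
     Group.monoid M \<and>
     (\<forall>i\<in>Obj C. \<pi> i \<in> monoid_hom M (D i)) \<and>
     (\<forall>f\<in>Arr C. \<forall>m\<in>carrier M. h f (\<pi> (Src C f) m) = \<pi> (Tgt C f) m)"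

definition compatible_families ::
  "('o, 'f) cat_data \<Rightarrow> ('o \<Rightarrow> 'a monoid) \<Rightarrow> ('f \<Rightarrow> 'a \<Rightarrow> 'a) \<Rightarrow> ('o \<Rightarrow> 'a) set" where
  "compatible_families C D h =
     {x \<in> (\<Pi>\<^sub>E i\<in>Obj C. carrier (D i)). \<forall>f\<in>Arr C. h f (x (Src C f)) = x (Tgt C f)}"

text \<open>The library's \<^const>\<open>product_group\<close> is the product of monoids; nothing in its definition
  uses inverses.\<close>

definition limit_monoid ::
  "('o, 'f) cat_data \<Rightarrow> ('o \<Rightarrow> 'a monoid) \<Rightarrow> ('f \<Rightarrow> 'a \<Rightarrow> 'a) \<Rightarrow> ('o \<Rightarrow> 'a) monoid" where
  "limit_monoid C D h = (product_group (Obj C) D)\<lparr>carrier := compatible_families C D h\<rparr>"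

text \<open>A limit is a cone whose comparison map to the monoid of compatible families is an
  isomorphism. The lemmas \<open>limit_cone_universal\<close> and \<open>universal_imp_limit_cone\<close> below show that this
  is the universal property.\<close>

definition limit_cone ::
  "('o, 'f) cat_data \<Rightarrow> ('o \<Rightarrow> 'a monoid) \<Rightarrow> ('f \<Rightarrow> 'a \<Rightarrow> 'a) \<Rightarrow>
   'm monoid \<Rightarrow> ('o \<Rightarrow> 'm \<Rightarrow> 'a) \<Rightarrow> bool" where
  "limit_cone C D h M \<pi> \<longleftrightarrow>
     monoid_cone C D h M \<pi> \<and>
     (\<lambda>m. \<lambda>i\<in>Obj C. \<pi> i m) \<in> iso M (limit_monoid C D h)"

text \<open>Uniqueness of the mediating homomorphism is up to equality on the carrier.\<close>

definition universal_for ::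
  "('o, 'f) cat_data \<Rightarrow> ('o \<Rightarrow> 'a monoid) \<Rightarrow> ('f \<Rightarrow> 'a \<Rightarrow> 'a) \<Rightarrow>
   'm monoid \<Rightarrow> ('o \<Rightarrow> 'm \<Rightarrow> 'a) \<Rightarrow> 'n monoid \<Rightarrow> ('o \<Rightarrow> 'n \<Rightarrow> 'a) \<Rightarrow> bool" where
  "universal_for C D h M \<pi> N \<rho> \<longleftrightarrow>
     (\<exists>u\<in>monoid_hom N M. \<forall>i\<in>Obj C. \<forall>n\<in>carrier N. \<pi> i (u n) = \<rho> i n) \<and>
     (\<forall>u\<in>monoid_hom N M. \<forall>v\<in>monoid_hom N M.
        (\<forall>i\<in>Obj C. \<forall>n\<in>carrier N. \<pi> i (u n) = \<rho> i n) \<longrightarrow>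
        (\<forall>i\<in>Obj C. \<forall>n\<in>carrier N. \<pi> i (v n) = \<rho> i n) \<longrightarrow>
        (\<forall>n\<in>carrier N. u n = v n))"

lemma limit_cone_universal:
  fixes N :: "'n monoid"
  assumes D: "monoid_diagram C D h"
    and L: "limit_cone C D h M \<pi>" and N: "monoid_cone C D h N \<rho>"
  shows "universal_for C D h M \<pi> N \<rho>"
proof -
  define c where "c = (\<lambda>m. \<lambda>i\<in>Obj C. \<pi> i m)"
  let ?K = "compatible_families C D h"
  have M: "Group.monoid M" and \<pi>: "\<And>i. i \<in> Obj C \<Longrightarrow> \<pi> i \<in> monoid_hom M (D i)"
    and bij: "bij_betw c (carrier M) ?K"
    using L by (auto simp: limit_cone_def monoid_cone_def iso_def limit_monoid_def c_def)
  interpret M: Group.monoid M by (rule M)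
  interpret N: Group.monoid N using N by (simp add: monoid_cone_def)
  have inj: "m = m'"
    if "m \<in> carrier M" "m' \<in> carrier M" "\<And>i. i \<in> Obj C \<Longrightarrow> \<pi> i m = \<pi> i m'" for m m'
  proof -
    have "c m = c m'" using that(3) by (auto simp: c_def)
    then show ?thesis using bij that(1,2) by (auto simp: bij_betw_def inj_on_def)
  qed
  have \<pi>m: "\<pi> i (x \<otimes>\<^bsub>M\<^esub> y) = \<pi> i x \<otimes>\<^bsub>D i\<^esub> \<pi> i y"
    if "i \<in> Obj C" "x \<in> carrier M" "y \<in> carrier M" for i x y
    using \<pi>[OF that(1)] that by (auto simp: monoid_hom_def hom_def)
  have \<pi>1: "\<pi> i \<one>\<^bsub>M\<^esub> = \<one>\<^bsub>D i\<^esub>" if "i \<in> Obj C" for i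
    using \<pi>[OF that] by (auto simp: monoid_hom_def)
  have \<rho>: "\<rho> i \<in> monoid_hom N (D i)" if "i \<in> Obj C" for i
    using N that by (auto simp: monoid_cone_def)
  have \<rho>m: "\<rho> i (x \<otimes>\<^bsub>N\<^esub> y) = \<rho> i x \<otimes>\<^bsub>D i\<^esub> \<rho> i y"
    if "i \<in> Obj C" "x \<in> carrier N" "y \<in> carrier N" for i x y
    using \<rho>[OF that(1)] that by (auto simp: monoid_hom_def hom_def)
  have \<rho>1: "\<rho> i \<one>\<^bsub>N\<^esub> = \<one>\<^bsub>D i\<^esub>" if "i \<in> Obj C" for i
    using \<rho>[OF that] by (auto simp: monoid_hom_def)
  have ends: "\<forall>f\<in>Arr C. Src C f \<in> Obj C \<and> Tgt C f \<in> Obj C"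
    using D by (simp add: monoid_diagram_def small_category_def)
  have K: "(\<lambda>i\<in>Obj C. \<rho> i n) \<in> ?K" if "n \<in> carrier N" for n
    using N that ends \<rho> by (auto simp: monoid_cone_def compatible_families_def monoid_hom_def hom_def)
  have "\<exists>m\<in>carrier M. c m = (\<lambda>i\<in>Obj C. \<rho> i n)" if "n \<in> carrier N" for n
    using K[OF that] bij by (metis bij_betw_imp_surj_on imageE)
  then obtain u where u: "\<And>n. n \<in> carrier N \<Longrightarrow> u n \<in> carrier M"
      "\<And>n. n \<in> carrier N \<Longrightarrow> c (u n) = (\<lambda>i\<in>Obj C. \<rho> i n)"
    by metis
  have \<pi>u: "\<pi> i (u n) = \<rho> i n" if "i \<in> Obj C" "n \<in> carrier N" for i n
    using fun_cong[OF u(2)[OF that(2)], of i] that(1) by (simp add: c_def)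
  have "u (x \<otimes>\<^bsub>N\<^esub> y) = u x \<otimes>\<^bsub>M\<^esub> u y" if "x \<in> carrier N" "y \<in> carrier N" for x y
    by (rule inj) (simp_all add: that u \<pi>u \<pi>m \<rho>m)
  moreover have "u \<one>\<^bsub>N\<^esub> = \<one>\<^bsub>M\<^esub>"
    by (rule inj) (simp_all add: u \<pi>u \<pi>1 \<rho>1)
  ultimately have "u \<in> monoid_hom N M"
    by (auto simp: monoid_hom_def hom_def u)
  moreover have "v n = w n"
    if "v \<in> monoid_hom N M" "w \<in> monoid_hom N M" "n \<in> carrier N"
      "\<forall>i\<in>Obj C. \<forall>n\<in>carrier N. \<pi> i (v n) = \<rho> i n"
      "\<forall>i\<in>Obj C. \<forall>n\<in>carrier N. \<pi> i (w n) = \<rho> i n" for v w n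
    using that by (intro inj) (auto simp: monoid_hom_def hom_def)
  ultimately show ?thesis
    unfolding universal_for_def using \<pi>u by blast
qed

lemma limit_monoid_cone:
  assumes D: "monoid_diagram C D h"
  shows "monoid_cone C D h (limit_monoid C D h) (\<lambda>i x. x i)"
proof -
  have ends: "\<And>f. f \<in> Arr C \<Longrightarrow> Src C f \<in> Obj C \<and> Tgt C f \<in> Obj C"
    and mon: "\<And>i. i \<in> Obj C \<Longrightarrow> Group.monoid (D i)"
    and hm: "\<And>f. f \<in> Arr C \<Longrightarrow> h f \<in> monoid_hom (D (Src C f)) (D (Tgt C f))"
    using D by (auto simp: monoid_diagram_def small_category_def)
  have hmul: "h f (a \<otimes>\<^bsub>D (Src C f)\<^esub> b) = h f a \<otimes>\<^bsub>D (Tgt C f)\<^esub> h f b"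
    if "f \<in> Arr C" "a \<in> carrier (D (Src C f))" "b \<in> carrier (D (Src C f))" for f a b
    using hm[OF that(1)] that by (auto simp: monoid_hom_def hom_def)
  have h1: "h f \<one>\<^bsub>D (Src C f)\<^esub> = \<one>\<^bsub>D (Tgt C f)\<^esub>" if "f \<in> Arr C" for f
    using hm[OF that] by (auto simp: monoid_hom_def)
  have "Group.monoid (limit_monoid C D h)"
  proof (rule Group.monoidI)
    fix x y assume "x \<in> carrier (limit_monoid C D h)" "y \<in> carrier (limit_monoid C D h)"
    then show "x \<otimes>\<^bsub>limit_monoid C D h\<^esub> y \<in> carrier (limit_monoid C D h)"
      by (simp add: limit_monoid_def compatible_families_def PiE_iff ends mon hmul monoid.m_closed)
  next
    show "\<one>\<^bsub>limit_monoid C D h\<^esub> \<in> carrier (limit_monoid C D h)"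
      by (simp add: limit_monoid_def compatible_families_def PiE_iff ends mon h1 monoid.one_closed)
  next
    fix x y z
    assume "x \<in> carrier (limit_monoid C D h)" "y \<in> carrier (limit_monoid C D h)"
      "z \<in> carrier (limit_monoid C D h)"
    then show "x \<otimes>\<^bsub>limit_monoid C D h\<^esub> y \<otimes>\<^bsub>limit_monoid C D h\<^esub> z =
        x \<otimes>\<^bsub>limit_monoid C D h\<^esub> (y \<otimes>\<^bsub>limit_monoid C D h\<^esub> z)"
      by (simp add: limit_monoid_def compatible_families_def PiE_iff mon monoid.m_assoc
          cong: restrict_cong)
  next
    fix x assume "x \<in> carrier (limit_monoid C D h)"
    then have x: "\<And>i. i \<in> Obj C \<Longrightarrow> x i \<in> carrier (D i)" "x = restrict x (Obj C)"
      by (auto simp: limit_monoid_def compatible_families_def PiE_iff extensional_restrict)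
    have "(\<lambda>i\<in>Obj C. \<one>\<^bsub>D i\<^esub> \<otimes>\<^bsub>D i\<^esub> x i) = restrict x (Obj C)"
      "(\<lambda>i\<in>Obj C. x i \<otimes>\<^bsub>D i\<^esub> \<one>\<^bsub>D i\<^esub>) = restrict x (Obj C)"
      by (auto intro!: restrict_ext simp: x(1) mon monoid.l_one monoid.r_one)
    then show "\<one>\<^bsub>limit_monoid C D h\<^esub> \<otimes>\<^bsub>limit_monoid C D h\<^esub> x = x"
      "x \<otimes>\<^bsub>limit_monoid C D h\<^esub> \<one>\<^bsub>limit_monoid C D h\<^esub> = x"
      using x(2) by (simp_all add: limit_monoid_def cong: restrict_cong)
  qed
  moreover have "(\<lambda>x. x i) \<in> monoid_hom (limit_monoid C D h) (D i)" if "i \<in> Obj C" for i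
    using that by (auto simp: limit_monoid_def compatible_families_def monoid_hom_def hom_def)
  ultimately show ?thesis
    by (auto simp: monoid_cone_def limit_monoid_def compatible_families_def)
qed

lemma universal_imp_limit_cone:
  fixes D :: "'o \<Rightarrow> 'a monoid"
  assumes D: "monoid_diagram C D h" and M: "monoid_cone C D h M \<pi>"
    and univ: "\<And>(N :: ('o \<Rightarrow> 'a) monoid) \<rho>. monoid_cone C D h N \<rho> \<Longrightarrow> universal_for C D h M \<pi> N \<rho>"
    and univ_self: "universal_for C D h M \<pi> M \<pi>"
  shows "limit_cone C D h M \<pi>"
proof -
  define L where "L = limit_monoid C D h"
  define c where "c = (\<lambda>m. \<lambda>i\<in>Obj C. \<pi> i m)"
  have ends: "\<And>f. f \<in> Arr C \<Longrightarrow> Src C f \<in> Obj C \<and> Tgt C f \<in> Obj C"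
    using D by (auto simp: monoid_diagram_def small_category_def)
  obtain u where u: "u \<in> monoid_hom L M" "\<forall>i\<in>Obj C. \<forall>x\<in>carrier L. \<pi> i (u x) = x i"
    using univ[OF limit_monoid_cone[OF D]] by (auto simp: universal_for_def L_def)
  interpret M: Group.monoid M using M by (simp add: monoid_cone_def)
  have c: "c \<in> monoid_hom M L"
    using M ends by (auto simp: c_def L_def monoid_cone_def limit_monoid_def compatible_families_def
        monoid_hom_def hom_def Pi_iff intro!: restrict_ext)
  have cu: "c (u x) = x" if "x \<in> carrier L" for x
    using u(2) that
    by (auto simp: c_def L_def limit_monoid_def compatible_families_def PiE_iff extensional_def
        restrict_def fun_eq_iff)
  have cL: "c m \<in> carrier L" if "m \<in> carrier M" for m
    using c that by (auto simp: monoid_hom_def hom_def)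
  have uc: "u \<circ> c \<in> monoid_hom M M"
    using u(1) c by (auto simp: monoid_hom_def hom_def Pi_iff)
  have id: "id \<in> monoid_hom M M"
    by (auto simp: monoid_hom_def hom_def)
  have \<pi>uc: "\<forall>i\<in>Obj C. \<forall>m\<in>carrier M. \<pi> i ((u \<circ> c) m) = \<pi> i m"
  proof (intro ballI)
    fix i m assume im: "i \<in> Obj C" "m \<in> carrier M"
    then have "\<pi> i (u (c m)) = c m i" using u(2) cL by blast
    then show "\<pi> i ((u \<circ> c) m) = \<pi> i m" using im by (simp add: c_def)
  qed
  have "\<forall>m\<in>carrier M. (u \<circ> c) m = id m"
  proof -
    have "\<forall>i\<in>Obj C. \<forall>m\<in>carrier M. \<pi> i (id m) = \<pi> i m" by simp
    with univ_self uc id \<pi>uc show ?thesis unfolding universal_for_def by blast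
  qed
  then have "bij_betw c (carrier M) (carrier L)"
    using cu cL u(1) by (intro bij_betw_byWitness[where f' = u]) (auto simp: monoid_hom_def hom_def)
  then have "c \<in> iso M L" using c by (auto simp: iso_def monoid_hom_def)
  then show ?thesis using M by (simp add: limit_cone_def c_def L_def)
qed

definition topological_monoid :: "'m monoid \<Rightarrow> 'm topology \<Rightarrow> bool" where
  "topological_monoid M \<tau> \<longleftrightarrow>
     Group.monoid M \<and> topspace \<tau> = carrier M \<and>
     continuous_map (prod_topology \<tau> \<tau>) \<tau> (\<lambda>(x, y). x \<otimes>\<^bsub>M\<^esub> y)"

definition coarsest_topology_making_continuous ::
  "'m set \<Rightarrow> 'o set \<Rightarrow> ('o \<Rightarrow> 'a topology) \<Rightarrow> ('o \<Rightarrow> 'm \<Rightarrow> 'a) \<Rightarrow> 'm topology \<Rightarrow> bool" where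
  "coarsest_topology_making_continuous S I Y \<pi> \<tau> \<longleftrightarrow>
     topspace \<tau> = S \<and> (\<forall>i\<in>I. continuous_map \<tau> (Y i) (\<pi> i)) \<and>
     (\<forall>\<sigma>. topspace \<sigma> = S \<and> (\<forall>i\<in>I. continuous_map \<sigma> (Y i) (\<pi> i)) \<longrightarrow>
        (\<forall>U. openin \<tau> U \<longrightarrow> openin \<sigma> U))"

text \<open>\<open>(M, \<tau>)\<close> is prodiscrete, exhibited by the limit cone \<open>\<pi>\<close> over the diagram \<open>(C, D, h)\<close>. The
  data is explicit because HOL cannot quantify over its types inside a definition. Continuity of
  the multiplication of \<open>M\<close> is not required here, as it follows.\<close>

definition prodiscrete_monoid_via ::
  "('o, 'f) cat_data \<Rightarrow> ('o \<Rightarrow> 'a monoid) \<Rightarrow> ('f \<Rightarrow> 'a \<Rightarrow> 'a) \<Rightarrow> ('o \<Rightarrow> 'm \<Rightarrow> 'a) \<Rightarrow>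
   'm monoid \<Rightarrow> 'm topology \<Rightarrow> bool" where
  "prodiscrete_monoid_via C D h \<pi> M \<tau> \<longleftrightarrow>
     monoid_diagram C D h \<and>
     limit_cone C D h M \<pi> \<and>
     coarsest_topology_making_continuous (carrier M) (Obj C)
       (\<lambda>i. discrete_topology (carrier (D i))) \<pi> \<tau>"

text \<open>\<open>inv_translate M p A\<close> is \<open>p\<^sup>*(A)\<close> and \<open>translate_class M p A\<close> is \<open>I\<^sub>A\<^sup>p\<close>.\<close>

definition inv_translate :: "'m monoid \<Rightarrow> 'm \<Rightarrow> 'm set \<Rightarrow> 'm set" where
  "inv_translate M p A = {m \<in> carrier M. p \<otimes>\<^bsub>M\<^esub> m \<in> A}"

definition translate_class :: "'m monoid \<Rightarrow> 'm \<Rightarrow> 'm set \<Rightarrow> 'm set" where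
  "translate_class M p A = {m \<in> carrier M. inv_translate M m A = inv_translate M p A}"

definition action_base :: "'m monoid \<Rightarrow> 'm topology \<Rightarrow> 'm set set" where
  "action_base M \<tau> =
     {A. A \<subseteq> carrier M \<and>
         (\<forall>p\<in>carrier M. \<forall>q\<in>carrier M. openin \<tau> (translate_class M p (inv_translate M q A)))}"

definition action_topology :: "'m monoid \<Rightarrow> 'm topology \<Rightarrow> 'm topology" where
  "action_topology M \<tau> = topology (arbitrary union_of (\<lambda>A. A \<in> action_base M \<tau>))"

lemma action_base_Int:
  assumes "A \<in> action_base M \<tau>" "B \<in> action_base M \<tau>"
  shows "A \<inter> B \<in> action_base M \<tau>"
proof -
  have "openin \<tau> (translate_class M p (inv_translate M q (A \<inter> B)))"
    if pq: "p \<in> carrier M" "q \<in> carrier M" for p q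
  proof (subst openin_subopen, intro ballI)
    fix m assume m: "m \<in> translate_class M p (inv_translate M q (A \<inter> B))"
    let ?T = "translate_class M m (inv_translate M q A) \<inter> translate_class M m (inv_translate M q B)"
    have mc: "m \<in> carrier M" using m by (simp add: translate_class_def)
    have Int: "inv_translate M n (inv_translate M q (A \<inter> B)) =
        inv_translate M n (inv_translate M q A) \<inter> inv_translate M n (inv_translate M q B)" for n
      by (auto simp: inv_translate_def)
    have "openin \<tau> ?T" using assms mc pq by (auto simp: action_base_def)
    moreover have "m \<in> ?T" using mc by (simp add: translate_class_def)
    moreover have "?T \<subseteq> translate_class M p (inv_translate M q (A \<inter> B))"
      using m by (auto simp: translate_class_def Int)
    ultimately show "\<exists>T. openin \<tau> T \<and> m \<in> T \<and> T \<subseteq> translate_class M p (inv_translate M q (A \<inter> B))"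
      by blast
  qed
  then show ?thesis using assms by (auto simp: action_base_def)
qed

lemma openin_action_topology:
  "openin (action_topology M \<tau>) = arbitrary union_of (\<lambda>A. A \<in> action_base M \<tau>)"
  unfolding action_topology_def
  by (intro topology_inverse' istopology_base action_base_Int)

definition right_powder_monoid :: "'m monoid \<Rightarrow> 'm topology \<Rightarrow> bool" where
  "right_powder_monoid M \<tau> \<longleftrightarrow>
     topological_monoid M \<tau> \<and> t0_space \<tau> \<and> \<tau> = action_topology M \<tau>"

end

theory Submission
  imports Defs
begin

text \<open>Proof idea: if \<open>A\<close> lies in the action base, then the class \<open>I\<^sub>A\<^sup>p\<close> of a point \<open>p \<in> A\<close> is an open
  neighbourhood of \<open>p\<close> inside \<open>A\<close>, because membership of \<open>m\<close> in \<open>A\<close> can be read off as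
  \<open>1 \<in> m\<^sup>*(A)\<close>; so the action topology is coarser than \<open>\<tau>\<close>. Conversely, if \<open>A\<close> is a preimage under
  some \<open>\<pi>\<^sub>i\<close>, then \<open>m\<^sup>*(q\<^sup>*(A))\<close> depends only on \<open>\<pi>\<^sub>i m\<close>, so its classes are again preimages under
  \<open>\<pi>\<^sub>i\<close>; hence every \<open>\<pi>\<^sub>i\<close> is continuous for the action topology, which is then finer than \<open>\<tau>\<close>.\<close>

text \<open>This is the universal property of the initial topology, obtained from minimality alone:
  one competing topology suffices, and no subbase of \<open>\<tau>\<close> has to be
  described.\<close>

lemma continuous_map_into_coarsest:
  assumes \<tau>: "coarsest_topology_making_continuous S I Y \<pi> \<tau>"
    and f: "f \<in> topspace X \<rightarrow> S"
    and cont: "\<And>i. i \<in> I \<Longrightarrow> continuous_map X (Y i) (\<pi> i \<circ> f)"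
  shows "continuous_map X \<tau> f"
proof -
  \<comment> \<open>The final topology \<open>\<sigma>\<close> along \<open>f\<close> makes every \<open>\<pi> i\<close> continuous, so it is finer than \<open>\<tau>\<close>.\<close>
  define pre where "pre U = {x \<in> topspace X. f x \<in> U}" for U
  define \<sigma> where "\<sigma> = topology (\<lambda>U. U \<subseteq> S \<and> openin X (pre U))"
  have "pre (U \<inter> V) = pre U \<inter> pre V" "pre (\<Union>\<K>) = \<Union> (pre ` \<K>)" for U V \<K>
    by (auto simp: pre_def)
  then have "istopology (\<lambda>U. U \<subseteq> S \<and> openin X (pre U))"
    unfolding istopology_def by (auto intro!: openin_Union)
  then have open\<sigma>: "openin \<sigma> U \<longleftrightarrow> U \<subseteq> S \<and> openin X (pre U)" for U
    by (simp add: \<sigma>_def topology_inverse')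
  have "pre S = topspace X" using f by (auto simp: pre_def)
  then have top\<sigma>: "topspace \<sigma> = S"
    by (metis open\<sigma> openin_subset openin_topspace order_refl subset_antisym)
  have \<tau>top: "topspace \<tau> = S" and \<pi>: "\<And>i. i \<in> I \<Longrightarrow> continuous_map \<tau> (Y i) (\<pi> i)"
    using \<tau> by (auto simp: coarsest_topology_making_continuous_def)
  have "continuous_map \<sigma> (Y i) (\<pi> i)" if i: "i \<in> I" for i
    unfolding continuous_map_def
  proof (intro conjI allI impI)
    show "\<pi> i \<in> topspace \<sigma> \<rightarrow> topspace (Y i)"
      using continuous_map_funspace[OF \<pi>[OF i]] by (simp add: \<tau>top top\<sigma>)
    fix V assume "openin (Y i) V"
    then have "openin X {x \<in> topspace X. (\<pi> i \<circ> f) x \<in> V}"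
      using cont[OF i] openin_continuous_map_preimage by blast
    moreover have "pre {x \<in> S. \<pi> i x \<in> V} = {x \<in> topspace X. (\<pi> i \<circ> f) x \<in> V}"
      using f by (auto simp: pre_def)
    ultimately show "openin \<sigma> {x \<in> topspace \<sigma>. \<pi> i x \<in> V}"
      by (simp add: top\<sigma> open\<sigma>)
  qed
  then have "openin \<sigma> U" if "openin \<tau> U" for U
    using \<tau> top\<sigma> that unfolding coarsest_topology_making_continuous_def by blast
  \<comment> \<open>Openness in \<open>\<sigma>\<close> means by construction that the preimage
    under \<open>f\<close> is open, so \<open>\<sigma>\<close> being finer than
    \<open>\<tau>\<close> is continuity of \<open>f\<close>.\<close>
  then show ?thesis
    using f by (auto simp: continuous_map_def \<tau>top open\<sigma> pre_def)
qed

text \<open>Every translate of the whole carrier is the carrier again, so it has a single class and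
  lies in the base. This lets the action topology compete in the minimality clause for
  \<open>\<tau>\<close>.\<close>

lemma topspace_action_topology:
  assumes "Group.monoid M" and "topspace \<tau> = carrier M"
  shows "topspace (action_topology M \<tau>) = carrier M"
proof -
  interpret Group.monoid M by fact
  have "inv_translate M p (carrier M) = carrier M" if "p \<in> carrier M" for p
    using that by (auto simp: inv_translate_def)
  then have "translate_class M p (carrier M) = carrier M" if "p \<in> carrier M" for p
    using that by (auto simp: translate_class_def)
  with \<open>\<And>p. p \<in> carrier M \<Longrightarrow> inv_translate M p (carrier M) = carrier M\<close>
  have "carrier M \<in> action_base M \<tau>"
    by (simp add: action_base_def flip: assms(2))
  then have "openin (action_topology M \<tau>) (carrier M)"
    by (simp add: openin_action_topology arbitrary_union_of_inc)
  moreover have "U \<subseteq> carrier M" if "openin (action_topology M \<tau>) U" for U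
    using that by (auto simp: openin_action_topology union_of_def arbitrary_def action_base_def)
  ultimately show ?thesis
    by (meson openin_subset openin_topspace subset_antisym)
qed

lemma openin_action_topology_imp_openin:
  assumes "Group.monoid M" and "openin (action_topology M \<tau>) U"
  shows "openin \<tau> U"
proof -
  interpret Group.monoid M by fact
  have base: "openin \<tau> A" if A: "A \<in> action_base M \<tau>" for A
  proof (subst openin_subopen, intro ballI)
    fix p assume pA: "p \<in> A"
    have sub: "A \<subseteq> carrier M" using A by (simp add: action_base_def)
    then have p: "p \<in> carrier M" using pA by blast
    \<comment> \<open>Taking \<open>q\<close> to be the unit in the base condition makes the classes
      of \<open>A\<close> itself open.\<close>
    have "inv_translate M \<one>\<^bsub>M\<^esub> A = A" using sub by (auto simp: inv_translate_def)
    then have "openin \<tau> (translate_class M p A)"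
      using A p one_closed unfolding action_base_def by (metis (mono_tags, lifting) mem_Collect_eq)
    moreover have "p \<in> translate_class M p A" using p by (simp add: translate_class_def)
    moreover have "translate_class M p A \<subseteq> A"
    proof
      fix m assume m: "m \<in> translate_class M p A"
      have "\<one>\<^bsub>M\<^esub> \<in> inv_translate M p A" using p pA by (simp add: inv_translate_def)
      then have "\<one>\<^bsub>M\<^esub> \<in> inv_translate M m A" using m by (simp add: translate_class_def)
      then show "m \<in> A" using m by (simp add: inv_translate_def translate_class_def)
    qed
    ultimately show "\<exists>T. openin \<tau> T \<and> p \<in> T \<and> T \<subseteq> A" by blast
  qed
  then show ?thesis
    using assms(2) by (auto simp: openin_action_topology union_of_def arbitrary_def)
qed

lemma hom_preimage_in_action_base:
  assumes "Group.monoid M" and f: "f \<in> hom M N"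
    and cont: "continuous_map \<tau> (discrete_topology (carrier N)) f"
    and \<tau>: "topspace \<tau> = carrier M"
  shows "{m \<in> carrier M. f m \<in> V} \<in> action_base M \<tau>"
proof -
  interpret Group.monoid M by fact
  let ?A = "{m \<in> carrier M. f m \<in> V}"
  have fm: "f (x \<otimes>\<^bsub>M\<^esub> y) = f x \<otimes>\<^bsub>N\<^esub> f y" if "x \<in> carrier M" "y \<in> carrier M" for x y
    using f that by (simp add: hom_mult)
  have "openin \<tau> (translate_class M p (inv_translate M q ?A))"
    if p: "p \<in> carrier M" and q: "q \<in> carrier M" for p q
  proof (subst openin_subopen, intro ballI)
    fix m assume m: "m \<in> translate_class M p (inv_translate M q ?A)"
    have mc: "m \<in> carrier M" using m by (simp add: translate_class_def)
    \<comment> \<open>The fibre of \<open>f\<close> through \<open>m\<close> is open because points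
      of \<open>N\<close> are open.\<close>
    let ?T = "{n \<in> topspace \<tau>. f n \<in> {f m}}"
    have "openin \<tau> ?T"
      by (rule openin_continuous_map_preimage[OF cont]) (simp add: hom_in_carrier[OF f mc])
    moreover have "?T \<subseteq> translate_class M p (inv_translate M q ?A)"
    proof
      fix n assume "n \<in> ?T"
      then have n: "n \<in> carrier M" "f n = f m" by (auto simp: \<tau>)
      \<comment> \<open>For \<open>k\<close> in the carrier, membership in the left side means that
        the product of \<open>f q\<close>, \<open>f n\<close> and \<open>f k\<close> lies in
        \<open>V\<close>, which depends on \<open>n\<close> only through \<open>f n\<close>.\<close>
      then have "inv_translate M n (inv_translate M q ?A) = inv_translate M m (inv_translate M q ?A)"
        using mc q by (auto simp: inv_translate_def fm)
      then show "n \<in> translate_class M p (inv_translate M q ?A)"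
        using m n by (simp add: translate_class_def)
    qed
    ultimately show "\<exists>T. openin \<tau> T \<and> m \<in> T \<and> T \<subseteq> translate_class M p (inv_translate M q ?A)"
      using mc \<tau> by blast
  qed
  then show ?thesis by (simp add: action_base_def)
qed

text \<open>By the universal property of \<open>\<tau>\<close>, it suffices to follow multiplication
  by each \<open>\<pi> i\<close>. The result depends only on the images of both factors under
  \<open>\<pi> i\<close>, so it is constant on boxes of open fibres.\<close>

lemma topological_monoid_initial_discrete:
  assumes M: "Group.monoid M"
    and \<pi>: "\<And>i. i \<in> I \<Longrightarrow> \<pi> i \<in> hom M (N i)"
    and \<tau>: "coarsest_topology_making_continuous (carrier M) I
              (\<lambda>i. discrete_topology (carrier (N i))) \<pi> \<tau>"
  shows "topological_monoid M \<tau>"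
proof -
  interpret Group.monoid M by (rule M)
  have top: "topspace \<tau> = carrier M"
    and cont: "\<And>i. i \<in> I \<Longrightarrow> continuous_map \<tau> (discrete_topology (carrier (N i))) (\<pi> i)"
    using \<tau> by (auto simp: coarsest_topology_making_continuous_def)
  have "continuous_map (prod_topology \<tau> \<tau>) \<tau> (\<lambda>(x, y). x \<otimes>\<^bsub>M\<^esub> y)"
  proof (rule continuous_map_into_coarsest[OF \<tau>])
    show "(\<lambda>(x, y). x \<otimes>\<^bsub>M\<^esub> y) \<in> topspace (prod_topology \<tau> \<tau>) \<rightarrow> carrier M"
      by (auto simp: top)
    fix i assume i: "i \<in> I"
    have \<pi>m: "\<pi> i (x \<otimes>\<^bsub>M\<^esub> y) = \<pi> i x \<otimes>\<^bsub>N i\<^esub> \<pi> i y"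
      if "x \<in> carrier M" "y \<in> carrier M" for x y
      using \<pi>[OF i] that by (rule hom_mult)
    show "continuous_map (prod_topology \<tau> \<tau>) (discrete_topology (carrier (N i)))
            (\<pi> i \<circ> (\<lambda>(x, y). x \<otimes>\<^bsub>M\<^esub> y))"
      unfolding continuous_map_def
    proof (intro conjI allI impI)
      show "\<pi> i \<circ> (\<lambda>(x, y). x \<otimes>\<^bsub>M\<^esub> y)
          \<in> topspace (prod_topology \<tau> \<tau>) \<rightarrow> topspace (discrete_topology (carrier (N i)))"
        by (auto simp: top hom_in_carrier[OF \<pi>[OF i]])
      fix V
      let ?P = "{z \<in> topspace (prod_topology \<tau> \<tau>). (\<pi> i \<circ> (\<lambda>(x, y). x \<otimes>\<^bsub>M\<^esub> y)) z \<in> V}"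
      let ?fib = "\<lambda>a. {n \<in> topspace \<tau>. \<pi> i n \<in> {\<pi> i a}}"
      show "openin (prod_topology \<tau> \<tau>) ?P"
      proof (subst openin_prod_topology_alt, intro allI impI)
        fix x y assume xy: "(x, y) \<in> ?P"
        then have c: "x \<in> carrier M" "y \<in> carrier M" by (auto simp: top)
        have "openin \<tau> (?fib a)" if "a \<in> carrier M" for a
          by (rule openin_continuous_map_preimage[OF cont[OF i]]) (simp add: hom_in_carrier[OF \<pi>[OF i] that])
        then have "openin \<tau> (?fib x)" "openin \<tau> (?fib y)" using c by auto
        moreover have "x \<in> ?fib x" "y \<in> ?fib y" using c by (auto simp: top)
        moreover have "?fib x \<times> ?fib y \<subseteq> ?P" using xy by (auto simp: top \<pi>m)
        ultimately show "\<exists>U V. openin \<tau> U \<and> openin \<tau> V \<and> x \<in> U \<and> y \<in> V \<and> U \<times> V \<subseteq> ?P"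
          by blast
      qed
    qed
  qed
  then show ?thesis using M top by (simp add: topological_monoid_def)
qed

lemma action_topology_initial_discrete:
  assumes M: "Group.monoid M"
    and \<pi>: "\<And>i. i \<in> I \<Longrightarrow> \<pi> i \<in> hom M (N i)"
    and \<tau>: "coarsest_topology_making_continuous (carrier M) I
              (\<lambda>i. discrete_topology (carrier (N i))) \<pi> \<tau>"
  shows "\<tau> = action_topology M \<tau>"
proof -
  have top: "topspace \<tau> = carrier M"
    and cont: "\<And>i. i \<in> I \<Longrightarrow> continuous_map \<tau> (discrete_topology (carrier (N i))) (\<pi> i)"
    using \<tau> by (auto simp: coarsest_topology_making_continuous_def)
  note atop = topspace_action_topology[OF M top]
  have "continuous_map (action_topology M \<tau>) (discrete_topology (carrier (N i))) (\<pi> i)"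
    if i: "i \<in> I" for i
    using \<pi>[OF i] hom_preimage_in_action_base[OF M \<pi>[OF i] cont[OF i] top]
    by (auto simp: continuous_map_def atop hom_def openin_action_topology
        intro!: arbitrary_union_of_inc)
  \<comment> \<open>The action topology is inserted for \<open>\<sigma>\<close> in the minimality
    clause; \<open>atop\<close> supplies the required underlying set.\<close>
  then have "openin (action_topology M \<tau>) U" if "openin \<tau> U" for U
    using \<tau> atop that unfolding coarsest_topology_making_continuous_def by blast
  then show ?thesis
    using openin_action_topology_imp_openin[OF M] by (auto simp: topology_eq)
qed

lemma t0_space_separating_discrete:
  assumes cont: "\<And>i. i \<in> I \<Longrightarrow> continuous_map \<tau> (discrete_topology (Y i)) (\<pi> i)"
    and sep: "\<And>x y. \<lbrakk>x \<in> topspace \<tau>; y \<in> topspace \<tau>; x \<noteq> y\<rbrakk> \<Longrightarrow> \<exists>i\<in>I. \<pi> i x \<noteq> \<pi> i y"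
  shows "t0_space \<tau>"
  unfolding t0_space_def
proof (intro ballI impI)
  fix x y assume xy: "x \<in> topspace \<tau>" "y \<in> topspace \<tau>" "x \<noteq> y"
  then obtain i where i: "i \<in> I" "\<pi> i x \<noteq> \<pi> i y" using sep by blast
  have "\<pi> i x \<in> Y i" using continuous_map_funspace[OF cont[OF i(1)]] xy(1) by auto
  \<comment> \<open>The fibre through \<open>x\<close> contains \<open>x\<close> but not
    \<open>y\<close>.\<close>
  then have "openin \<tau> {m \<in> topspace \<tau>. \<pi> i m \<in> {\<pi> i x}}"
    by (intro openin_continuous_map_preimage[OF cont[OF i(1)]]) simp
  with xy i(2) show "\<exists>U. openin \<tau> U \<and> (x \<notin> U) = (y \<in> U)" by force
qed

theorem proposition2p21:
  fixes C :: "('o, 'f) cat_data"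
    and D :: "'o \<Rightarrow> 'a monoid"
    and h :: "'f \<Rightarrow> 'a \<Rightarrow> 'a"
    and \<pi> :: "'o \<Rightarrow> 'm \<Rightarrow> 'a"
    and M :: "'m monoid"
    and \<tau> :: "'m topology"
  assumes "prodiscrete_monoid_via C D h \<pi> M \<tau>"
  shows "right_powder_monoid M \<tau>"
proof -
  have M: "Group.monoid M" and \<pi>: "\<And>i. i \<in> Obj C \<Longrightarrow> \<pi> i \<in> hom M (D i)"
    and inj: "inj_on (\<lambda>m. \<lambda>i\<in>Obj C. \<pi> i m) (carrier M)"
    and \<tau>: "coarsest_topology_making_continuous (carrier M) (Obj C)
              (\<lambda>i. discrete_topology (carrier (D i))) \<pi> \<tau>"
    using assms by (auto simp: prodiscrete_monoid_via_def limit_cone_def monoid_cone_def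
        monoid_hom_def iso_def bij_betw_def)
  have "t0_space \<tau>"
  proof (rule t0_space_separating_discrete)
    show "continuous_map \<tau> (discrete_topology (carrier (D i))) (\<pi> i)" if "i \<in> Obj C" for i
      using \<tau> that by (simp add: coarsest_topology_making_continuous_def)
    fix x y assume "x \<in> topspace \<tau>" "y \<in> topspace \<tau>" "x \<noteq> y"
    moreover have "topspace \<tau> = carrier M"
      using \<tau> by (simp add: coarsest_topology_making_continuous_def)
    \<comment> \<open>Separation comes from the limit property: the comparison map to compatible
      families is injective, so distinct points differ in some coordinate.\<close>
    ultimately have "(\<lambda>i\<in>Obj C. \<pi> i x) \<noteq> (\<lambda>i\<in>Obj C. \<pi> i y)"
      using inj by (auto dest: inj_onD)
    then show "\<exists>i\<in>Obj C. \<pi> i x \<noteq> \<pi> i y" by (meson restrict_ext)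
  qed
  then show ?thesis
    using topological_monoid_initial_discrete[OF M \<pi> \<tau>] action_topology_initial_discrete[OF M \<pi> \<tau>]
    by (simp add: right_powder_monoid_def)
qed

end
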